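(* Let $A\in\mathbb{R}^{n\times n}$ be a symmetric positive definite matrix and let $B\in\mathbb{R}^{m\times n}$ and $C\in\mathbb{R}^{p\times m}$ be full row rank matrices. Let $P\in\mathbb{R}^{n\times n}$, $Q\in\mathbb{R}^{m\times m}$ and $W\in\mathbb{R}^{p\times p}$ be symmetric positive definite matrices, let $\alpha,\beta,\gamma>0$, and let $\mathcal{P}_{EGSS}$ be the corresponding extensive generalized shift-splitting preconditioner. Let $\lambda$ be a non-real eigenvalue of the EGSS preconditioned matrix $\mathcal{P}_{EGSS}^{-1}\mathcal{A}$, i.e. $\Im(\lambda)\neq0$, and let ${\bf p}=[u^T,v^T,w^T]^T$ be a corresponding eigenvector (with $u\in\mathbb{C}^n$, $v\in\mathbb{C}^m$, $w\in\mathbb{C}^p$). Then: (1) If $Cv=0$, $\lambda$ satisfies $$\frac{2\tilde\kappa_{\min}}{2\alpha+\tilde\kappa_{\min}}\leq|\lambda|\leq\sqrt{\frac{4\tilde\tau_{\max}}{\alpha\beta+\beta\tilde\kappa_{\min}+\tilde\tau_{\max}}}.$$ (2) If $Cv\neq0$, the real and imaginary parts of $\lambda/(2-\lambda)$ satisfy $$\frac{\tilde\kappa_{\min}\,\tilde\tau_{\min}}{2\left(\beta\tilde\kappa_{\max}^2+\alpha\tilde\tau_{\max}+(\alpha^2/\gamma)\tilde\beta_{\max}\right)}\leq\Re\left(\frac{\lambda}{2-\lambda}\right)\leq\frac{\tilde\kappa_{\max}}{2\alpha}$$ and $$\left|\Im\left(\frac{\lambda}{2-\lambda}\right)\right|\leq\sqrt{\frac{1}{\alpha\beta}\tilde\tau_{\max}+\frac{1}{\beta\gamma}\tilde\beta_{\max}}.$$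 Here $\tilde\kappa_{\min}=\lambda_{\min}(P^{-1}A)$, $\tilde\kappa_{\max}=\lambda_{\max}(P^{-1}A)$, $\tilde\tau_{\max}=\lambda_{\max}(Q^{-1}BP^{-1}B^T)$, $\tilde\tau_{\min}=\lambda_{\min}(Q^{-1}BP^{-1}B^T)$ and $\tilde\beta_{\max}=\lambda_{\max}(Q^{-1}C^TW^{-1}C)$.
   Context: The saddle point matrix is $\mathcal{A}=\begin{bmatrix}A&B^T&0\\-B&0&-C^T\\0&C&0\end{bmatrix}$. The extensive generalized shift-splitting (EGSS) preconditioner is $$\mathcal{P}_{EGSS}=\frac12\begin{bmatrix}\alpha P+A&B^T&0\\-B&\beta Q&-C^T\\0&C&\gamma W\end{bmatrix}.$$ $\lambda_{\max}(\cdot)$ and $\lambda_{\min}(\cdot)$ denote the maximum and minimum eigenvalues of a matrix with real eigenvalues. *)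

theory Defs
  imports "HOL-Analysis.Analysis"
begin

definition spd :: "real^'n^'n \<Rightarrow> bool" where
  "spd M \<longleftrightarrow> transpose M = M \<and> (\<forall>x. x \<noteq> 0 \<longrightarrow> x \<bullet> (M *v x) > 0)"

definition eigenvector :: "'a::field^'n^'n \<Rightarrow> 'a^'n \<Rightarrow> 'a \<Rightarrow> bool" where
  "eigenvector M x k \<longleftrightarrow> x \<noteq> 0 \<and> M *v x = k *s x"

definition eigenvalue :: "'a::field^'n^'n \<Rightarrow> 'a \<Rightarrow> bool" where
  "eigenvalue M k \<longleftrightarrow> (\<exists>x. eigenvector M x k)"

text \<open>
  The next two notions are meant for real matrices all of whose complex eigenvalues are real,
  such as \<open>S\<inverse>T\<close> with \<open>S\<close> symmetric positive definite and \<open>T\<close> symmetric: only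
  real eigenvalues are taken into account.
\<close>

definition lambda_max :: "real^'n^'n \<Rightarrow> real" where
  "lambda_max M = Max {k. eigenvalue M k}"

definition lambda_min :: "real^'n^'n \<Rightarrow> real" where
  "lambda_min M = Min {k. eigenvalue M k}"

abbreviation cmat :: "real^'n^'m \<Rightarrow> complex^'n^'m" where
  "cmat \<equiv> map_matrix complex_of_real"

text \<open>Block vectors and matrices are indexed by the sum type \<open>'n + 'm + 'p\<close>.\<close>

definition block_vec3 :: "'a^'n \<Rightarrow> 'a^'m \<Rightarrow> 'a^'p \<Rightarrow> 'a^('n + 'm + 'p)" where
  "block_vec3 u v w = (\<chi> i. case i of
      Inl a \<Rightarrow> u $ a
    | Inr (Inl b) \<Rightarrow> v $ b
    | Inr (Inr c) \<Rightarrow> w $ c)"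

text \<open>The nine blocks are given row by row.\<close>

definition block_mat3 ::
  "'a^'n^'n \<Rightarrow> 'a^'m^'n \<Rightarrow> 'a^'p^'n \<Rightarrow>
   'a^'n^'m \<Rightarrow> 'a^'m^'m \<Rightarrow> 'a^'p^'m \<Rightarrow>
   'a^'n^'p \<Rightarrow> 'a^'m^'p \<Rightarrow> 'a^'p^'p \<Rightarrow> 'a^('n + 'm + 'p)^('n + 'm + 'p)" where
  "block_mat3 M11 M12 M13 M21 M22 M23 M31 M32 M33 = (\<chi> i. case i of
      Inl a \<Rightarrow> block_vec3 (M11 $ a) (M12 $ a) (M13 $ a)
    | Inr (Inl b) \<Rightarrow> block_vec3 (M21 $ b) (M22 $ b) (M23 $ b)
    | Inr (Inr c) \<Rightarrow> block_vec3 (M31 $ c) (M32 $ c) (M33 $ c))"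

definition saddle_mat ::
  "real^'n^'n \<Rightarrow> real^'n^'m \<Rightarrow> real^'m^'p \<Rightarrow> real^('n + 'm + 'p)^('n + 'm + 'p)" where
  "saddle_mat A B C = block_mat3
      A     (transpose B) 0
      (- B) 0             (- transpose C)
      0     C             0"

definition P_EGSS ::
  "real \<Rightarrow> real \<Rightarrow> real \<Rightarrow> real^'n^'n \<Rightarrow> real^'m^'m \<Rightarrow> real^'p^'p \<Rightarrow>
   real^'n^'n \<Rightarrow> real^'n^'m \<Rightarrow> real^'m^'p \<Rightarrow> real^('n + 'm + 'p)^('n + 'm + 'p)" where
  "P_EGSS \<alpha> \<beta> \<gamma> P Q W A B C = (1/2) *\<^sub>R block_mat3
      (\<alpha> *\<^sub>R P + A) (transpose B) 0
      (- B)         (\<beta> *\<^sub>R Q)    (- transpose C)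
      0             C             (\<gamma> *\<^sub>R W)"

end

(*
  Put theta = lam / (2 - lam). Since P_EGSS is half the sum of the saddle point matrix S and
  D = diag (alpha P, beta Q, gamma W), the eigenvalue equation becomes S x = theta D x with x = [u, v, w]. Pairing
  its three block rows with u, v, w and writing a = u*Au, p = u*Pu, q = v*Qv, r = w*Ww, the
  off-diagonal contributions cancel, and as theta is non-real, imaginary and real parts give
    beta q = alpha p + gamma r   and   a = 2 (Re theta) beta q.
  The first identity bounds Re theta from above; together with Cauchy-Schwarz estimates of v*Bu
  and w*Cv it bounds |Im theta|. The lower bound for Re theta needs a bound for q / p, which comes
  from the P-inverse norm of B^T v = theta alpha P u - A u. If C v = 0 then r = 0, and the
  identities bound Re theta below and |theta| above, which transfers to lam = 2 theta / (1 + theta).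
*)
theory Submission
  imports Defs
begin

subsection \<open>Extreme eigenvalues of symmetric pencils\<close>

lemma inner_transpose_mult:
  fixes M :: "real^'n^'m"
  shows "x \<bullet> (M *v y) = (transpose M *v x) \<bullet> y"
  by (simp add: dot_lmul_matrix)

lemma invertible_if_ker:
  fixes M :: "'a::field^'n^'n"
  assumes "\<And>x. M *v x = 0 \<Longrightarrow> x = 0"
  shows "invertible M"
  using assms by (auto simp: invertible_left_inverse matrix_left_invertible_ker)

lemma matrix_inv_mult:
  fixes M :: "'a::field^'n^'n"
  assumes "invertible M"
  shows "M ** matrix_inv M = mat 1" "matrix_inv M ** M = mat 1"
proof -
  obtain N where "M ** N = mat 1 \<and> N ** M = mat 1"
    using assms by (auto simp: invertible_def)
  then have "M ** matrix_inv M = mat 1 \<and> matrix_inv M ** M = mat 1"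
    unfolding matrix_inv_def by (rule someI)
  then show "M ** matrix_inv M = mat 1" "matrix_inv M ** M = mat 1" by auto
qed

lemma spd_invertible: "spd S \<Longrightarrow> invertible S"
  by (rule invertible_if_ker) (force simp: spd_def)

lemma symmetric_inner_swap:
  fixes S :: "real^'n^'n"
  assumes "transpose S = S"
  shows "x \<bullet> (S *v y) = y \<bullet> (S *v x)"
  using inner_transpose_mult[of x S y] assms by (metis inner_commute)

lemma spd_nonneg: "spd S \<Longrightarrow> 0 \<le> x \<bullet> (S *v x)"
  by (cases "x = 0") (auto simp: spd_def less_imp_le)

text \<open>If \<open>G *v x\<close> were nonzero, moving from \<open>x\<close> a little against
  \<open>y = G *v x\<close> would make the form negative, because the term linear in the step
  outweighs the quadratic one.\<close>

lemma psd_kernel: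
  fixes G :: "real^'n^'n"
  assumes sym: "transpose G = G" and psd: "\<And>y. 0 \<le> y \<bullet> (G *v y)"
    and zero: "x \<bullet> (G *v x) = 0"
  shows "G *v x = 0"
proof (rule ccontr)
  assume "G *v x \<noteq> 0"
  define y where "y = G *v x"
  define c where "c = y \<bullet> (G *v y)"
  define n where "n = y \<bullet> y"
  \<comment> \<open>The form at \<open>x + t y\<close> will be \<open>2 t n + t^2 c\<close>, minimal
    at \<open>- n / c\<close>. The denominator \<open>c + 1\<close> covers \<open>c = 0\<close> as
    well and turns the value into \<open>t n - t^2\<close>.\<close>
  define t where "t = - n / (c + 1)"
  have n: "n > 0" using \<open>G *v x \<noteq> 0\<close> by (simp add: n_def y_def)
  have c: "c \<ge> 0" using psd by (simp add: c_def)
  have "x \<bullet> (G *v y) = n"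
    using symmetric_inner_swap[OF sym, of x y] by (simp add: n_def y_def)
  then have "(x + t *\<^sub>R y) \<bullet> (G *v (x + t *\<^sub>R y)) = 2 * t * n + t\<^sup>2 * c"
    using zero by (simp add: c_def n_def y_def algebra_simps matrix_vector_right_distrib
        matrix_vector_mult_scaleR power2_eq_square)
  moreover have "t * (c + 1) = - n" "t < 0"
    using n c by (simp_all add: t_def)
  then have "2 * t * n + t\<^sup>2 * c = t * n - t\<^sup>2" "t * n < 0"
    using n by (algebra, simp add: mult_neg_pos)
  then have "2 * t * n + t\<^sup>2 * c < 0" by (smt (verit) zero_le_power2)
  ultimately show False using psd[of "x + t *\<^sub>R y"] by linarith
qed

text \<open>The Rayleigh quotient of \<open>T\<close> relative to \<open>S\<close> attains a maximum
  \<open>k\<close> on the compact unit sphere. Then \<open>k S - T\<close> is positive semidefinite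
  and its form vanishes at the maximiser, so \<open>psd_kernel\<close> yields the eigenvalue
  equation.\<close>

lemma pencil_max_eigenpair:
  fixes S T :: "real^'n^'n"
  assumes S: "spd S" and T: "transpose T = T"
  obtains k x where "x \<noteq> 0" "T *v x = k *s (S *v x)" "\<And>y. y \<bullet> (T *v y) \<le> k * (y \<bullet> (S *v y))"
proof -
  define r where "r y = (y \<bullet> (T *v y)) / (y \<bullet> (S *v y))" for y
  have pos: "y \<bullet> (S *v y) > 0" if "y \<noteq> 0" for y
    using S that by (simp add: spd_def)
  have "\<forall>y\<in>sphere 0 1. y \<bullet> (S *v y) \<noteq> 0"
    using pos by (metis less_irrefl mem_sphere_0 norm_zero zero_neq_one)
  then have "continuous_on (sphere 0 1) r"
    unfolding r_def
    by (intro continuous_intros linear_continuous_on bounded_linear_intros)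
  moreover have "(axis undefined 1 :: real^'n) \<in> sphere 0 1"
    by simp
  then have "sphere 0 1 \<noteq> ({} :: (real^'n) set)" by blast
  ultimately obtain x where x: "x \<in> sphere 0 1" "\<And>y. y \<in> sphere 0 1 \<Longrightarrow> r y \<le> r x"
    using continuous_attains_sup[OF compact_sphere] by metis
  define k where "k = r x"
  have "x \<noteq> 0" using x by auto
  have le: "y \<bullet> (T *v y) \<le> k * (y \<bullet> (S *v y))" for y
  proof (cases "y = 0")
    case False
    have "r (y /\<^sub>R norm y) = r y"
      using False by (simp add: r_def matrix_vector_mult_scaleR)
    then have "r y \<le> k"
      using x(2)[of "y /\<^sub>R norm y"] False by (simp add: k_def)
    then show ?thesis using pos[OF False] by (simp add: r_def field_simps)
  qed simp
  define G where "G = k *\<^sub>R S - T"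
  have G: "G *v y = k *\<^sub>R (S *v y) - T *v y" for y
    by (simp add: G_def matrix_vector_mult_diff_rdistrib scaleR_matrix_vector_assoc)
  have "G *v x = 0"
  proof (rule psd_kernel)
    show "transpose G = G" using S T
      by (simp add: G_def spd_def vec_eq_iff transpose_def)
    show "0 \<le> y \<bullet> (G *v y)" for y using le[of y] by (simp add: G inner_diff_right)
    show "x \<bullet> (G *v x) = 0" using pos[OF \<open>x \<noteq> 0\<close>]
      by (simp add: G inner_diff_right k_def r_def)
  qed
  then have "T *v x = k *s (S *v x)" by (simp add: G scalar_mult_eq_scaleR)
  then show thesis using that \<open>x \<noteq> 0\<close> le by blast
qed

text \<open>Passes from \<open>matrix_inv S ** T\<close>, which need not be symmetric even for
  symmetric \<open>S\<close> and \<open>T\<close>, to the pencil of \<open>T\<close> and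
  \<open>S\<close>.\<close>

lemma eigenvalue_inv_mult_iff:
  fixes S T :: "'a::field^'n^'n"
  assumes "invertible S"
  shows "eigenvalue (matrix_inv S ** T) k \<longleftrightarrow> (\<exists>x. x \<noteq> 0 \<and> T *v x = k *s (S *v x))"
proof -
  note inv = matrix_inv_mult[OF assms]
  have "(matrix_inv S ** T) *v x = k *s x \<longleftrightarrow> T *v x = k *s (S *v x)" for x
  proof
    assume "(matrix_inv S ** T) *v x = k *s x"
    then have "S *v (matrix_inv S *v (T *v x)) = S *v (k *s x)"
      by (simp add: matrix_vector_mul_assoc)
    then show "T *v x = k *s (S *v x)"
      by (simp add: matrix_vector_mul_assoc matrix_mul_assoc inv vector_scalar_commute)
  next
    assume "T *v x = k *s (S *v x)"
    then have "matrix_inv S *v (T *v x) = matrix_inv S *v (S *v (k *s x))"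
      by (simp add: vector_scalar_commute)
    then show "(matrix_inv S ** T) *v x = k *s x"
      by (simp add: matrix_vector_mul_assoc inv)
  qed
  then show ?thesis by (auto simp: eigenvalue_def eigenvector_def)
qed

text \<open>Eigenvectors for distinct eigenvalues are orthogonal in the inner product given by
  \<open>S\<close>, hence linearly independent. Finiteness is what gives \<open>Max\<close> and
  \<open>Min\<close> in \<open>lambda_max\<close> and \<open>lambda_min\<close> their
  meaning.\<close>

lemma finite_eigenvalues_pencil:
  fixes S T :: "real^'n^'n"
  assumes S: "spd S" and T: "transpose T = T"
  shows "finite {k. eigenvalue (matrix_inv S ** T) k}"
proof -
  let ?K = "{k. eigenvalue (matrix_inv S ** T) k}"
  have "\<forall>k\<in>?K. \<exists>x. x \<noteq> 0 \<and> T *v x = k *\<^sub>R (S *v x)"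
    using eigenvalue_inv_mult_iff[OF spd_invertible[OF S]] by (auto simp: scalar_mult_eq_scaleR)
  then obtain f where f: "\<And>k. k \<in> ?K \<Longrightarrow> f k \<noteq> 0 \<and> T *v f k = k *\<^sub>R (S *v f k)"
    by metis
  have orth: "f k \<bullet> (S *v f l) = 0" if "k \<in> ?K" "l \<in> ?K" "k \<noteq> l" for k l
  proof -
    have "f k \<bullet> (T *v f l) = f l \<bullet> (T *v f k)" by (rule symmetric_inner_swap[OF T])
    then have "l * (f k \<bullet> (S *v f l)) = k * (f l \<bullet> (S *v f k))"
      using f that by simp
    moreover have "f l \<bullet> (S *v f k) = f k \<bullet> (S *v f l)"
      using S by (intro symmetric_inner_swap) (simp add: spd_def)
    ultimately show ?thesis using that by simp
  qed
  have pos: "f k \<bullet> (S *v f k) > 0" if "k \<in> ?K" for k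
    using S f[OF that] by (simp add: spd_def)
  have inj: "inj_on f ?K"
    using orth pos by (intro inj_onI) (metis less_irrefl)
  have "independent (f ` ?K)"
    unfolding dependent_explicit
  proof clarify
    fix t c v
    assume t: "finite t" "t \<subseteq> f ` ?K" and sum: "(\<Sum>v\<in>t. c v *\<^sub>R v) = 0"
      and v: "v \<in> t" "c v \<noteq> 0"
    obtain k where k: "k \<in> ?K" "v = f k" using t v by blast
    \<comment> \<open>Pairing the vanishing combination with \<open>S *v v\<close> isolates the
      coefficient of \<open>v\<close>, by orthogonality.\<close>
    have "0 = (\<Sum>z\<in>t. c z *\<^sub>R z) \<bullet> (S *v v)" by (simp add: sum)
    also have "\<dots> = (\<Sum>z\<in>t. c z * (z \<bullet> (S *v v)))" by (simp add: inner_sum_left)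
    also have "\<dots> = (\<Sum>z\<in>t. if z = v then c v * (v \<bullet> (S *v v)) else 0)"
    proof (rule sum.cong)
      fix z assume "z \<in> t"
      then obtain l where "l \<in> ?K" "z = f l" using t by blast
      then show "c z * (z \<bullet> (S *v v)) = (if z = v then c v * (v \<bullet> (S *v v)) else 0)"
        using orth[of l k] k by auto
    qed simp
    also have "\<dots> = c v * (v \<bullet> (S *v v))" using t v by simp
    finally show False using v pos k by force
  qed
  then have "finite (f ` ?K)" by (rule independent_imp_finite)
  then show ?thesis using inj finite_imageD by blast
qed

text \<open>The eigenvalue that dominates all Rayleigh quotients is one of the finitely many
  eigenvalues, so it is at most their maximum, and its bound carries over.\<close>

lemma eigenvalue_lambda_max:
  fixes S T :: "real^'n^'n"
  assumes S: "spd S" and T: "transpose T = T"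
  shows "eigenvalue (matrix_inv S ** T) (lambda_max (matrix_inv S ** T))"
    and "y \<bullet> (T *v y) \<le> lambda_max (matrix_inv S ** T) * (y \<bullet> (S *v y))"
proof -
  let ?K = "{k. eigenvalue (matrix_inv S ** T) k}"
  obtain k x where kx: "x \<noteq> 0" "T *v x = k *s (S *v x)"
      "\<And>y. y \<bullet> (T *v y) \<le> k * (y \<bullet> (S *v y))"
    using pencil_max_eigenpair[OF assms] by blast
  then have k: "k \<in> ?K"
    using eigenvalue_inv_mult_iff[OF spd_invertible[OF S]] by auto
  have "Max ?K \<in> ?K" using finite_eigenvalues_pencil[OF assms] k by (intro Max_in) auto
  then show "eigenvalue (matrix_inv S ** T) (lambda_max (matrix_inv S ** T))"
    by (simp add: lambda_max_def)
  have "k \<le> lambda_max (matrix_inv S ** T)"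
    using finite_eigenvalues_pencil[OF assms] k by (simp add: lambda_max_def)
  moreover have "0 \<le> y \<bullet> (S *v y)" using S by (rule spd_nonneg)
  ultimately show "y \<bullet> (T *v y) \<le> lambda_max (matrix_inv S ** T) * (y \<bullet> (S *v y))"
    using kx(3)[of y] by (meson mult_right_mono order_trans)
qed

text \<open>The maximal eigenpair for \<open>- T\<close> gives, after negation, an eigenvalue of the
  original pencil that lies below all its Rayleigh quotients.\<close>

lemma eigenvalue_lambda_min:
  fixes S T :: "real^'n^'n"
  assumes S: "spd S" and T: "transpose T = T"
  shows "eigenvalue (matrix_inv S ** T) (lambda_min (matrix_inv S ** T))"
    and "lambda_min (matrix_inv S ** T) * (y \<bullet> (S *v y)) \<le> y \<bullet> (T *v y)"
proof -
  let ?K = "{k. eigenvalue (matrix_inv S ** T) k}"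
  have neg: "(- T) *v y = - (T *v y)" for y
    using matrix_vector_mult_diff_rdistrib[of 0 T y] by simp
  have "transpose (- T) = - T" using T by (simp add: transpose_def vec_eq_iff)
  then obtain k x where kx: "x \<noteq> 0" "(- T) *v x = k *s (S *v x)"
      "\<And>y. y \<bullet> ((- T) *v y) \<le> k * (y \<bullet> (S *v y))"
    using pencil_max_eigenpair[OF S] by blast
  then have "T *v x = (- k) *s (S *v x)" by (metis neg minus_minus vec.scale_minus_left)
  then have k: "- k \<in> ?K"
    using eigenvalue_inv_mult_iff[OF spd_invertible[OF S]] kx by blast
  have "Min ?K \<in> ?K" using finite_eigenvalues_pencil[OF assms] k by (intro Min_in) auto
  then show "eigenvalue (matrix_inv S ** T) (lambda_min (matrix_inv S ** T))"
    by (simp add: lambda_min_def)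
  have "lambda_min (matrix_inv S ** T) \<le> - k"
    using finite_eigenvalues_pencil[OF assms] k by (simp add: lambda_min_def)
  moreover have "0 \<le> y \<bullet> (S *v y)" using S by (rule spd_nonneg)
  ultimately have "lambda_min (matrix_inv S ** T) * (y \<bullet> (S *v y)) \<le> (- k) * (y \<bullet> (S *v y))"
    by (rule mult_right_mono)
  then show "lambda_min (matrix_inv S ** T) * (y \<bullet> (S *v y)) \<le> y \<bullet> (T *v y)"
    using kx(3)[of y] by (simp add: neg)
qed

subsection \<open>Quadratic forms on complex vectors\<close>

definition cdot :: "complex^'n \<Rightarrow> complex^'n \<Rightarrow> complex" where
  "cdot x y = (\<Sum>i\<in>UNIV. cnj (x $ i) * y $ i)"

lemma cdot_add_right: "cdot x (y + z) = cdot x y + cdot x z"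
  and cdot_diff_right: "cdot x (y - z) = cdot x y - cdot x z"
  and cdot_diff_left: "cdot (y - z) x = cdot y x - cdot z x"
  and cdot_minus_right: "cdot x (- y) = - cdot x y"
  and cdot_smult_right: "cdot x (c *s y) = c * cdot x y"
  and cdot_smult_left: "cdot (c *s x) y = cnj c * cdot x y"
  by (simp_all add: cdot_def algebra_simps sum.distrib sum_subtractf sum_negf sum_distrib_left)

lemma cdot_zero [simp]: "cdot x 0 = 0" "cdot 0 x = 0"
  by (simp_all add: cdot_def)

lemma cdot_commute: "cdot y x = cnj (cdot x y)"
  by (simp add: cdot_def mult.commute)

lemma cdot_transpose:
  "cdot x (cmat M *v y) = cdot (cmat (transpose M) *v x) y"
proof -
  have "cdot x (cmat M *v y) = (\<Sum>i\<in>UNIV. \<Sum>j\<in>UNIV. cnj (x $ i) * complex_of_real (M $ i $ j) * y $ j)"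
    by (simp add: cdot_def matrix_vector_mult_def sum_distrib_left mult.assoc)
  also have "\<dots> = (\<Sum>j\<in>UNIV. \<Sum>i\<in>UNIV. cnj (x $ i) * complex_of_real (M $ i $ j) * y $ j)"
    by (rule sum.swap)
  also have "\<dots> = cdot (cmat (transpose M) *v x) y"
    by (simp add: cdot_def matrix_vector_mult_def transpose_def sum_distrib_left mult_ac
        del: transpose_matrix_vector)
  finally show ?thesis .
qed

lemma cmat_mult: "cmat (M ** N) = cmat M ** cmat N"
  by (simp add: vec_eq_iff matrix_matrix_mult_def)

lemma cmat_mat [simp]: "cmat (mat 1) = mat 1"
  by (simp add: vec_eq_iff mat_def)

text \<open>The real part makes the form real-valued for every \<open>M\<close>. For symmetric
  \<open>M\<close> nothing is lost, as \<open>cdot_qform\<close> shows.\<close>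

definition qform :: "real^'n^'n \<Rightarrow> complex^'n \<Rightarrow> real" where
  "qform M x = Re (cdot x (cmat M *v x))"

text \<open>The mixed products of real and imaginary parts contribute only to the imaginary part,
  because \<open>M\<close> is real. Hence estimates for real forms transfer to complex vectors by
  addition.\<close>

lemma qform_parts:
  fixes M :: "real^'n^'n"
  defines "re \<equiv> \<lambda>x. \<chi> i. Re (x $ i)" and "im \<equiv> \<lambda>x. \<chi> i. Im (x $ i)"
  shows "qform M x = re x \<bullet> (M *v re x) + im x \<bullet> (M *v im x)"
  by (simp add: qform_def cdot_def re_def im_def inner_vec_def matrix_vector_mult_def
      sum_distrib_left sum.distrib algebra_simps)

lemma cdot_qform:
  assumes "transpose M = M"
  shows "cdot x (cmat M *v x) = of_real (qform M x)"
proof -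
  have "cnj (cdot x (cmat M *v x)) = cdot x (cmat M *v x)"
    using cdot_transpose[of x M x] assms by (simp flip: cdot_commute del: transpose_matrix_vector)
  then show ?thesis
    by (simp add: qform_def complex_eq_iff)
qed

lemma qform_pos:
  assumes "spd M" "x \<noteq> 0"
  shows "qform M x > 0"
proof -
  have "(\<chi> i. Re (x $ i)) \<noteq> 0 \<or> (\<chi> i. Im (x $ i)) \<noteq> 0"
    using assms(2) by (auto simp: vec_eq_iff complex_eq_iff)
  then show ?thesis
    unfolding qform_parts using assms(1) spd_nonneg
    by (auto simp: spd_def intro: add_pos_nonneg add_nonneg_pos)
qed

lemma qform_nonneg: "spd M \<Longrightarrow> qform M x \<ge> 0"
  using qform_pos[of M x] by (cases "x = 0") (auto simp: qform_def)

lemma qform_zero [simp]: "qform M 0 = 0"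
  by (simp add: qform_def)

lemma qform_le_lambda_max:
  assumes "spd S" "transpose T = T"
  shows "qform T x \<le> lambda_max (matrix_inv S ** T) * qform S x"
  unfolding qform_parts distrib_left by (intro add_mono eigenvalue_lambda_max assms)

lemma lambda_min_le_qform:
  assumes "spd S" "transpose T = T"
  shows "lambda_min (matrix_inv S ** T) * qform S x \<le> qform T x"
  unfolding qform_parts distrib_left by (intro add_mono eigenvalue_lambda_min assms)

text \<open>The minimum is attained at an eigenvector, where it is a quotient of two positive
  forms.\<close>

lemma lambda_min_pos:
  assumes S: "spd S" and T: "spd T"
  shows "lambda_min (matrix_inv S ** T) > 0"
proof -
  let ?k = "lambda_min (matrix_inv S ** T)"
  have "transpose T = T" using T by (simp add: spd_def)
  then obtain x where x: "x \<noteq> 0" "T *v x = ?k *s (S *v x)"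
    using eigenvalue_lambda_min(1)[OF S] eigenvalue_inv_mult_iff[OF spd_invertible[OF S]] by blast
  then have "x \<bullet> (T *v x) = ?k * (x \<bullet> (S *v x))"
    by (simp add: scalar_mult_eq_scaleR)
  then show ?thesis
    using S T x(1) by (metis spd_def zero_less_mult_pos2)
qed

lemma cauchy_schwarz_spd:
  assumes S: "spd S"
  shows "(cmod (cdot x (cmat S *v y)))\<^sup>2 \<le> qform S x * qform S y"
proof (cases "y = 0")
  case False
  have sym: "transpose S = S" using S by (simp add: spd_def)
  define z where "z = cdot x (cmat S *v y)"
  define q where "q = qform S y"
  have q: "q > 0" using qform_pos[OF S False] by (simp add: q_def)
  \<comment> \<open>With this \<open>c\<close>, the vector \<open>c *s y\<close> is the projection
    of \<open>x\<close> onto \<open>y\<close>, orthogonal for the inner product of \<open>S\<close>.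
    The form at the remainder \<open>x - c *s y\<close> is nonnegative, and this is the
    inequality.\<close>
  define c where "c = cnj z / of_real q"
  have yx: "cdot y (cmat S *v x) = cnj z"
    unfolding z_def using sym by (metis cdot_commute cdot_transpose)
  have "cdot (x - c *s y) (cmat S *v (x - c *s y)) =
      of_real (qform S x) - c * z - cnj c * cnj z + cnj c * c * of_real q"
    by (simp add: matrix_vector_mult_diff_distrib vector_scalar_commute cdot_diff_right
        cdot_diff_left cdot_smult_left cdot_smult_right cdot_qform[OF sym] yx
        flip: z_def q_def) (simp add: algebra_simps)
  also have "\<dots> = of_real (qform S x - (cmod z)\<^sup>2 / q)"
  proof -
    have "z * cnj z = of_real ((cmod z)\<^sup>2)" by (rule complex_norm_square[symmetric])
    then have "c * z = of_real ((cmod z)\<^sup>2 / q)" "cnj c * cnj z = of_real ((cmod z)\<^sup>2 / q)"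
      "cnj c * c * of_real q = of_real ((cmod z)\<^sup>2 / q)"
      using q by (simp_all add: c_def mult.commute)
    then show ?thesis by simp
  qed
  finally have "qform S (x - c *s y) = qform S x - (cmod z)\<^sup>2 / q"
    by (simp add: qform_def)
  then have "(cmod z)\<^sup>2 / q \<le> qform S x"
    using qform_nonneg[OF S, of "x - c *s y"] by simp
  then show ?thesis using q by (simp add: field_simps z_def q_def)
qed simp

section \<open>Gram matrices \<open>M S^-1 M^T\<close> and their quadratic forms\<close>

lemma transpose_matrix_inv:
  fixes S :: "real^'n^'n"
  assumes "invertible S"
  shows "transpose (matrix_inv S) = matrix_inv (transpose S)"
proof -
  note inv = matrix_inv_mult[OF assms]
  have "transpose (matrix_inv S) ** transpose S = mat 1"
    using inv by (metis matrix_transpose_mul transpose_mat)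
  moreover have "transpose S ** matrix_inv (transpose S) = mat 1"
    using assms transpose_invertible by (intro matrix_inv_mult) blast
  ultimately show ?thesis
    by (metis matrix_mul_assoc matrix_mul_lid matrix_mul_rid)
qed

lemma transpose_gram:
  assumes "spd S"
  shows "transpose (M ** matrix_inv S ** transpose M) = M ** matrix_inv S ** transpose M"
  using assms transpose_matrix_inv[OF spd_invertible[OF assms]]
  by (simp add: matrix_transpose_mul matrix_mul_assoc spd_def)

text \<open>The vector \<open>S^-1 M^T x\<close> represents the functional sending \<open>y\<close>
  to \<open>x* M y\<close> in the inner product of \<open>S\<close>. The Gram form is therefore the
  squared dual norm of this functional.\<close>

lemma cdot_gram:
  assumes S: "spd S"
  shows "qform (M ** matrix_inv S ** transpose M) x
    = qform S (cmat (matrix_inv S ** transpose M) *v x)"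
    and "cdot (cmat (matrix_inv S ** transpose M) *v x) (cmat S *v y) = cdot x (cmat M *v y)"
proof -
  let ?z = "cmat (matrix_inv S ** transpose M) *v x"
  have "cmat S *v ?z = cmat (S ** matrix_inv S ** transpose M) *v x"
    by (simp add: cmat_mult matrix_vector_mul_assoc matrix_mul_assoc)
  then have Sz: "cmat S *v ?z = cmat (transpose M) *v x"
    using matrix_inv_mult[OF spd_invertible[OF S]] by simp
  have sym: "transpose S = S" using S by (simp add: spd_def)
  show zy: "cdot ?z (cmat S *v y) = cdot x (cmat M *v y)" for y
    using cdot_transpose[of ?z S y] cdot_transpose[of x M y] sym Sz by metis
  show "qform (M ** matrix_inv S ** transpose M) x = qform S ?z"
    using zy[of ?z] by (simp add: qform_def cmat_mult matrix_vector_mul_assoc matrix_mul_assoc)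
qed

text \<open>This is Cauchy-Schwarz for \<open>S\<close>, applied to the representing vector of
  \<open>cdot_gram\<close>. It serves for the coupling terms \<open>v* B u\<close> and
  \<open>w* C v\<close>.\<close>

lemma cauchy_schwarz_gram:
  assumes "spd S"
  shows "(cmod (cdot x (cmat M *v y)))\<^sup>2 \<le> qform (M ** matrix_inv S ** transpose M) x * qform S y"
  using cauchy_schwarz_spd[OF assms] cdot_gram[OF assms] by metis

text \<open>For \<open>z = S^-1 T x\<close> the Gram form \<open>g\<close> equals both
  \<open>z* S z\<close> and \<open>x* T z\<close>. Cauchy-Schwarz for \<open>T\<close> and the
  eigenvalue bound on each factor give \<open>g^2 \<le> k^2 (x* S x) g\<close>, and one factor
  \<open>g\<close> cancels. No matrix square root enters.\<close>

lemma qform_gram_le: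
  assumes S: "spd S" and T: "spd T"
  shows "qform (T ** matrix_inv S ** transpose T) x \<le> (lambda_max (matrix_inv S ** T))\<^sup>2 * qform S x"
proof (cases "x = 0")
  case False
  define k where "k = lambda_max (matrix_inv S ** T)"
  define z where "z = cmat (matrix_inv S ** transpose T) *v x"
  define g where "g = qform (T ** matrix_inv S ** transpose T) x"
  have sym: "transpose T = T" using T by (simp add: spd_def)
  have bound: "qform T y \<le> k * qform S y" for y
    unfolding k_def by (rule qform_le_lambda_max[OF S sym])
  have k: "k > 0"
    using qform_pos[OF T False] qform_pos[OF S False] bound[of x]
    by (metis order_less_le_trans zero_less_mult_pos2)
  have gz: "g = qform S z" unfolding g_def z_def by (rule cdot_gram[OF S])
  then have "g \<ge> 0" using qform_nonneg[OF S] by simp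
  have "of_real g = cdot x (cmat T *v z)"
    using cdot_gram(2)[OF S, of T x z] cdot_qform[of S z] S gz by (simp add: z_def spd_def)
  then have "g = cmod (cdot x (cmat T *v z))"
    using \<open>g \<ge> 0\<close> by (metis norm_of_real abs_of_nonneg)
  then have "g\<^sup>2 \<le> qform T x * qform T z"
    using cauchy_schwarz_spd[OF T] by simp
  also have "\<dots> \<le> (k * qform S x) * (k * g)"
    using bound[of x] bound[of z] qform_nonneg[OF T] gz by (intro mult_mono) (auto intro: order_trans)
  finally have "g * g \<le> (k\<^sup>2 * qform S x) * g"
    by (simp add: power2_eq_square mult_ac)
  then have "g \<le> k\<^sup>2 * qform S x"
    using \<open>g \<ge> 0\<close> qform_nonneg[OF S, of x] by (cases "g = 0") auto
  then show ?thesis by (simp add: g_def k_def)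
qed simp

subsection \<open>Block structure\<close>

lemma block_vec3_eq_iff:
  "block_vec3 x y z = block_vec3 x' y' z' \<longleftrightarrow> x = x' \<and> y = y' \<and> z = z'"
proof
  assume eq: "block_vec3 x y z = block_vec3 x' y' z'"
  have "x $ i = x' $ i" for i
    using arg_cong[OF eq, of "\<lambda>t. t $ Inl i"] by (simp add: block_vec3_def)
  moreover have "y $ i = y' $ i" for i
    using arg_cong[OF eq, of "\<lambda>t. t $ Inr (Inl i)"] by (simp add: block_vec3_def)
  moreover have "z $ i = z' $ i" for i
    using arg_cong[OF eq, of "\<lambda>t. t $ Inr (Inr i)"] by (simp add: block_vec3_def)
  ultimately show "x = x' \<and> y = y' \<and> z = z'" by (simp add: vec_eq_iff)
qed simp

lemma block_vec3_cases:
  obtains x y z where "t = block_vec3 x y z"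
proof
  show "t = block_vec3 (\<chi> i. t $ Inl i) (\<chi> i. t $ Inr (Inl i)) (\<chi> i. t $ Inr (Inr i))"
    by (simp add: vec_eq_iff block_vec3_def split: sum.split)
qed

lemma block_vec3_zero: "block_vec3 0 0 0 = 0"
  by (simp add: vec_eq_iff block_vec3_def split: sum.split)

lemma block_vec3_smult: "c *s block_vec3 x y z = block_vec3 (c *s x) (c *s y) (c *s z)"
  by (simp add: vec_eq_iff block_vec3_def split: sum.split)

lemma sum_UNIV_Plus:
  fixes f :: "'a::finite + 'b::finite \<Rightarrow> 'c::comm_monoid_add"
  shows "sum f UNIV = (\<Sum>i\<in>UNIV. f (Inl i)) + (\<Sum>i\<in>UNIV. f (Inr i))"
  by (simp add: sum.Plus flip: UNIV_Plus_UNIV)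

lemma block_mat3_mult_vec:
  "block_mat3 M11 M12 M13 M21 M22 M23 M31 M32 M33 *v block_vec3 x y z =
    block_vec3 (M11 *v x + M12 *v y + M13 *v z) (M21 *v x + M22 *v y + M23 *v z)
      (M31 *v x + M32 *v y + M33 *v z)"
  by (simp add: vec_eq_iff block_mat3_def block_vec3_def matrix_vector_mult_def sum_UNIV_Plus
      add.assoc split: sum.split)

lemma cmat_block_mat3:
  "cmat (block_mat3 M11 M12 M13 M21 M22 M23 M31 M32 M33) =
    block_mat3 (cmat M11) (cmat M12) (cmat M13) (cmat M21) (cmat M22) (cmat M23)
      (cmat M31) (cmat M32) (cmat M33)"
  by (simp add: vec_eq_iff block_mat3_def block_vec3_def split: sum.split)

lemma cmat_arith:
  "cmat 0 = 0" "cmat (- M) = - cmat M" "cmat (M + N) = cmat M + cmat N"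
  by (simp_all add: vec_eq_iff)

lemma cmat_scaleR_mult_vec: "cmat (c *\<^sub>R M) *v x = of_real c *s (cmat M *v x)"
  by (simp add: vec_eq_iff matrix_vector_mult_def sum_distrib_left mult.assoc)

lemma uminus_mult_vec: "(- M) *v x = - (M *v (x :: 'a::ring_1^'n))"
  by (simp add: vec_eq_iff matrix_vector_mult_def sum_negf)

section \<open>Action of the saddle point matrix and the preconditioner\<close>

lemma saddle_mat_mult_vec:
  "cmat (saddle_mat A B C) *v block_vec3 u v w =
    block_vec3 (cmat A *v u + cmat (transpose B) *v v)
      (- (cmat B *v u) - cmat (transpose C) *v w) (cmat C *v v)"
  by (simp add: saddle_mat_def cmat_block_mat3 block_mat3_mult_vec cmat_arith uminus_mult_vec
      del: transpose_matrix_vector)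

lemma P_EGSS_mult_vec:
  "cmat (P_EGSS \<alpha> \<beta> \<gamma> P Q W A B C) *v block_vec3 u v w =
    (1/2) *s (block_vec3 (of_real \<alpha> *s (cmat P *v u)) (of_real \<beta> *s (cmat Q *v v))
        (of_real \<gamma> *s (cmat W *v w))
      + cmat (saddle_mat A B C) *v block_vec3 u v w)"
  unfolding saddle_mat_mult_vec
  by (simp add: P_EGSS_def cmat_scaleR_mult_vec cmat_block_mat3 block_mat3_mult_vec cmat_arith
      uminus_mult_vec matrix_vector_mult_add_rdistrib del: transpose_matrix_vector)
    (simp add: vec_eq_iff block_vec3_def split: sum.split)

lemma P_EGSS_mult_real_vec:
  fixes x :: "real^'n" and y :: "real^'m" and z :: "real^'p"
  shows "P_EGSS \<alpha> \<beta> \<gamma> P Q W A B C *v block_vec3 x y z = (1/2) *\<^sub>R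
    block_vec3 (\<alpha> *\<^sub>R (P *v x) + A *v x + transpose B *v y)
      (- (B *v x) + \<beta> *\<^sub>R (Q *v y) - transpose C *v z) (C *v y + \<gamma> *\<^sub>R (W *v z))"
  by (simp add: P_EGSS_def block_mat3_mult_vec uminus_mult_vec matrix_vector_mult_add_rdistrib
      flip: scaleR_matrix_vector_assoc del: transpose_matrix_vector)

text \<open>Pairing the rows of the kernel equation with \<open>x\<close>, \<open>y\<close>,
  \<open>z\<close> and adding cancels the coupling terms. What remains is a sum of nonnegative forms
  equal to zero, so each block vanishes.\<close>

lemma invertible_P_EGSS:
  fixes A P :: "real^'n^'n" and B :: "real^'n^'m" and C :: "real^'m^'p"
  assumes "spd A" "spd P" "spd Q" "spd W" "\<alpha> > 0" "\<beta> > 0" "\<gamma> > 0"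
  shows "invertible (P_EGSS \<alpha> \<beta> \<gamma> P Q W A B C)"
proof (rule invertible_if_ker)
  fix t assume t: "P_EGSS \<alpha> \<beta> \<gamma> P Q W A B C *v t = 0"
  obtain x y z where xyz: "t = block_vec3 x y z" by (rule block_vec3_cases)
  have "block_vec3 (\<alpha> *\<^sub>R (P *v x) + A *v x + transpose B *v y)
      (- (B *v x) + \<beta> *\<^sub>R (Q *v y) - transpose C *v z) (C *v y + \<gamma> *\<^sub>R (W *v z)) = block_vec3 0 0 0"
    using t unfolding xyz P_EGSS_mult_real_vec by (simp add: block_vec3_zero)
  then have eqs: "\<alpha> *\<^sub>R (P *v x) + A *v x + transpose B *v y = 0"
      "- (B *v x) + \<beta> *\<^sub>R (Q *v y) - transpose C *v z = 0" "C *v y + \<gamma> *\<^sub>R (W *v z) = 0"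
    by (simp_all add: block_vec3_eq_iff del: transpose_matrix_vector)
  have "\<alpha> * (x \<bullet> (P *v x)) + x \<bullet> (A *v x) + y \<bullet> (B *v x) = 0"
    using arg_cong[OF eqs(1), of "\<lambda>t. x \<bullet> t"] inner_transpose_mult[of y B x]
    by (simp add: inner_add_right inner_commute del: transpose_matrix_vector)
  moreover have "- (y \<bullet> (B *v x)) + \<beta> * (y \<bullet> (Q *v y)) - z \<bullet> (C *v y) = 0"
    using arg_cong[OF eqs(2), of "\<lambda>t. y \<bullet> t"] inner_transpose_mult[of z C y]
    by (simp add: inner_add_right inner_diff_right inner_commute del: transpose_matrix_vector)
  moreover have "z \<bullet> (C *v y) + \<gamma> * (z \<bullet> (W *v z)) = 0"
    using arg_cong[OF eqs(3), of "\<lambda>t. z \<bullet> t"] by (simp add: inner_add_right)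
  ultimately have sum: "\<alpha> * (x \<bullet> (P *v x)) + x \<bullet> (A *v x) + \<beta> * (y \<bullet> (Q *v y))
      + \<gamma> * (z \<bullet> (W *v z)) = 0"
    by linarith
  have "\<alpha> * (x \<bullet> (P *v x)) \<ge> 0" "x \<bullet> (A *v x) \<ge> 0" "\<beta> * (y \<bullet> (Q *v y)) \<ge> 0"
      "\<gamma> * (z \<bullet> (W *v z)) \<ge> 0"
    using assms by (simp_all add: spd_nonneg)
  with sum have "x \<bullet> (A *v x) = 0" "\<beta> * (y \<bullet> (Q *v y)) = 0" "\<gamma> * (z \<bullet> (W *v z)) = 0"
    by linarith+
  then have "x = 0" "y = 0" "z = 0"
    using assms by (auto simp: spd_def)
  then show "t = 0" by (simp add: xyz block_vec3_zero)
qed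

lemma EGSS_eigenvector_shift:
  assumes inv: "invertible (P_EGSS \<alpha> \<beta> \<gamma> P Q W A B C)"
    and eig: "eigenvector (cmat (matrix_inv (P_EGSS \<alpha> \<beta> \<gamma> P Q W A B C) ** saddle_mat A B C))
      (block_vec3 u v w) lam"
    and "lam \<noteq> 2"
  defines "\<theta> \<equiv> lam / (2 - lam)"
  shows "cmat A *v u + cmat (transpose B) *v v = (\<theta> * of_real \<alpha>) *s (cmat P *v u)"
    and "- (cmat B *v u) - cmat (transpose C) *v w = (\<theta> * of_real \<beta>) *s (cmat Q *v v)"
    and "cmat C *v v = (\<theta> * of_real \<gamma>) *s (cmat W *v w)"
proof -
  let ?N = "P_EGSS \<alpha> \<beta> \<gamma> P Q W A B C" and ?p = "block_vec3 u v w"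
  let ?S = "block_vec3 (of_real \<alpha> *s (cmat P *v u)) (of_real \<beta> *s (cmat Q *v v))
        (of_real \<gamma> *s (cmat W *v w))"
  define s where "s = cmat (saddle_mat A B C) *v ?p"
  have "cmat ?N *v (cmat (matrix_inv ?N ** saddle_mat A B C) *v ?p) = s"
    by (simp add: s_def matrix_vector_mul_assoc matrix_mul_assoc matrix_inv_mult[OF inv]
        flip: cmat_mult)
  \<comment> \<open>The eigenvalue equation multiplied by the preconditioner. Each component solves
    to \<open>(2 - lam) s = lam ?S\<close>, which explains the quotient
    \<open>\<theta>\<close>.\<close>
  then have "s = lam *s ((1/2) *s (?S + s))"
    using eig by (simp add: eigenvector_def vector_scalar_commute P_EGSS_mult_vec s_def)
  then have comp: "s $ i = lam * (1/2 * (?S $ i + s $ i))" for i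
    by (metis vector_add_component vector_smult_component)
  have "s = \<theta> *s ?S"
  proof (simp only: vec_eq_iff vector_smult_component, rule allI)
    fix i show "s $ i = \<theta> * ?S $ i"
      using comp[of i] \<open>lam \<noteq> 2\<close> by (simp add: \<theta>_def field_simps)
  qed
  then show "cmat A *v u + cmat (transpose B) *v v = (\<theta> * of_real \<alpha>) *s (cmat P *v u)"
    "- (cmat B *v u) - cmat (transpose C) *v w = (\<theta> * of_real \<beta>) *s (cmat Q *v v)"
    "cmat C *v v = (\<theta> * of_real \<gamma>) *s (cmat W *v w)"
    by (simp_all add: s_def saddle_mat_mult_vec block_vec3_smult block_vec3_eq_iff
        del: transpose_matrix_vector)
qed

subsection \<open>Bounds for the shifted eigenvalue\<close>

text \<open>Collects the shifted problem free of \<open>lam\<close> and of the inverse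
  preconditioner, so that the bounds can be stated for \<open>\<theta>\<close> alone.\<close>

locale EGSS_eigenpair =
  fixes A P :: "real^'n^'n" and B :: "real^'n^'m" and C :: "real^'m^'p"
    and Q :: "real^'m^'m" and W :: "real^'p^'p"
    and \<alpha> \<beta> \<gamma> :: real and \<theta> :: complex
    and u :: "complex^'n" and v :: "complex^'m" and w :: "complex^'p"
  assumes spd: "spd A" "spd P" "spd Q" "spd W"
    and rank_B: "rank B = CARD('m)"
    and pos: "\<alpha> > 0" "\<beta> > 0" "\<gamma> > 0"
    and eq1: "cmat A *v u + cmat (transpose B) *v v = (\<theta> * of_real \<alpha>) *s (cmat P *v u)"
    and eq2: "- (cmat B *v u) - cmat (transpose C) *v w = (\<theta> * of_real \<beta>) *s (cmat Q *v v)"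
    and eq3: "cmat C *v v = (\<theta> * of_real \<gamma>) *s (cmat W *v w)"
    and nonreal: "Im \<theta> \<noteq> 0"
    and nonzero: "u \<noteq> 0 \<or> v \<noteq> 0 \<or> w \<noteq> 0"
begin

abbreviation (input) "a \<equiv> qform A u"
abbreviation (input) "p \<equiv> qform P u"
abbreviation (input) "q \<equiv> qform Q v"
abbreviation (input) "r \<equiv> qform W w"
abbreviation (input) "z \<equiv> cdot v (cmat B *v u)"

abbreviation (input) "\<kappa>_min \<equiv> lambda_min (matrix_inv P ** A)"
abbreviation (input) "\<kappa>_max \<equiv> lambda_max (matrix_inv P ** A)"
abbreviation (input) "\<tau>_max \<equiv> lambda_max (matrix_inv Q ** B ** matrix_inv P ** transpose B)"
abbreviation (input) "\<tau>_min \<equiv> lambda_min (matrix_inv Q ** B ** matrix_inv P ** transpose B)"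
abbreviation (input) "\<beta>_max \<equiv> lambda_max (matrix_inv Q ** transpose C ** matrix_inv W ** C)"

lemma blocks_symmetric: "transpose A = A" "transpose P = P" "transpose Q = Q" "transpose W = W"
  using spd by (auto simp: spd_def)

section \<open>Identities from pairing the block rows with the eigenvector\<close>

lemma cdot_B: "cdot u (cmat (transpose B) *v v) = cnj z"
  by (metis cdot_commute cdot_transpose)

lemma cdot_C: "cdot v (cmat (transpose C) *v w) = cnj (cdot w (cmat C *v v))"
  by (metis cdot_commute cdot_transpose)

lemma wC: "cdot w (cmat C *v v) = \<theta> * of_real (\<gamma> * r)"
  by (simp add: eq3 cdot_smult_right cdot_qform blocks_symmetric)

text \<open>The second row paired with \<open>v\<close>. Its \<open>C\<close> term is the conjugate
  of the one in the third row, hence the factor \<open>cnj \<theta>\<close>.\<close>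

lemma z_eq: "z = - \<theta> * of_real (\<beta> * q) - cnj \<theta> * of_real (\<gamma> * r)"
proof -
  have "cdot v (- (cmat B *v u) - cmat (transpose C) *v w) = \<theta> * of_real (\<beta> * q)"
    by (simp add: eq2 cdot_smult_right cdot_qform blocks_symmetric)
  then have "z = - (\<theta> * of_real (\<beta> * q)) - cdot v (cmat (transpose C) *v w)"
    unfolding cdot_diff_right cdot_minus_right by algebra
  then show ?thesis by (simp only: cdot_C wC) simp
qed

lemma first_row: "of_real a + cnj z = \<theta> * of_real (\<alpha> * p)"
proof -
  have "cdot u (cmat A *v u + cmat (transpose B) *v v) = \<theta> * of_real (\<alpha> * p)"
    by (simp add: eq1 cdot_smult_right cdot_qform blocks_symmetric)
  then show ?thesis by (simp only: cdot_add_right cdot_B cdot_qform[OF blocks_symmetric(1)])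
qed

text \<open>Full row rank makes the real matrix \<open>transpose B\<close> injective, and this
  applies to the real and imaginary parts of \<open>v\<close> separately.\<close>

lemma transpose_B_inj:
  assumes "cmat (transpose B) *v v = 0"
  shows "v = 0"
proof -
  have inj: "inj ((*v) (transpose B))"
    using rank_B by (simp add: rank_transpose del: transpose_matrix_vector flip: full_rank_injective)
  define re im where "re = (\<chi> i. Re (v $ i))" and "im = (\<chi> i. Im (v $ i))"
  have "transpose B *v re = 0" "transpose B *v im = 0"
    using assms by (simp_all add: vec_eq_iff complex_eq_iff matrix_vector_mult_def re_def im_def
        del: transpose_matrix_vector)
  then have "re = 0" "im = 0"
    using inj by (metis injD matrix_vector_mult_0_right)+
  then show ?thesis by (simp add: vec_eq_iff complex_eq_iff re_def im_def)
qed

lemma theta_nonzero: "\<theta> \<noteq> 0"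
  using nonreal by auto

lemma w_zero: "cmat C *v v = 0 \<Longrightarrow> r = 0"
  using wC theta_nonzero pos by simp

text \<open>If \<open>u\<close> vanished, the first row would force \<open>v = 0\<close> and then
  the third row \<open>w = 0\<close>. This makes \<open>p\<close> and \<open>a\<close> positive and
  allows division by them.\<close>

lemma u_nonzero: "u \<noteq> 0"
proof
  assume u: "u = 0"
  then have "v = 0" using eq1 transpose_B_inj by simp
  moreover from this have "r = 0" by (intro w_zero) simp
  then have "w = 0" using qform_pos[OF spd(4)] by force
  ultimately show False using u nonzero by simp
qed

lemma forms_pos: "a > 0" "p > 0" "q \<ge> 0" "r \<ge> 0"
  using u_nonzero spd by (simp_all add: qform_pos qform_nonneg)

text \<open>Imaginary parts of \<open>first_row\<close> and \<open>z_eq\<close>: all terms carry the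
  factor \<open>Im \<theta>\<close>, which cancels, and the conjugation in \<open>z_eq\<close> gives
  \<open>r\<close> the sign opposite to \<open>q\<close>.\<close>

lemma balance: "\<beta> * q = \<alpha> * p + \<gamma> * r"
proof -
  have "- Im z = Im \<theta> * (\<alpha> * p)"
    using arg_cong[OF first_row, of Im] by simp
  moreover have "Im z = Im \<theta> * (\<gamma> * r - \<beta> * q)"
    by (simp add: z_eq algebra_simps)
  ultimately have "Im \<theta> * (\<beta> * q - \<gamma> * r) = Im \<theta> * (\<alpha> * p)"
    by (simp add: algebra_simps)
  then show ?thesis using nonreal by simp
qed

lemma q_pos: "q > 0"
  using balance forms_pos pos by (metis add_pos_nonneg mult_nonneg_nonneg mult_pos_pos
      less_imp_le zero_less_mult_pos)

text \<open>Real parts give \<open>a = Re \<theta> (\<alpha> p + \<beta> q + \<gamma> r)\<close>,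
  and by \<open>balance\<close> the bracket is \<open>2 \<beta> q\<close>.\<close>

lemma Re_theta: "a = 2 * Re \<theta> * (\<beta> * q)"
proof -
  have "a + Re z = Re \<theta> * (\<alpha> * p)"
    using arg_cong[OF first_row, of Re] by simp
  moreover have "Re z = - Re \<theta> * (\<beta> * q) - Re \<theta> * (\<gamma> * r)"
    by (simp add: z_eq)
  moreover have "\<alpha> * p = \<beta> * q - \<gamma> * r" using balance by simp
  ultimately show ?thesis by (simp add: algebra_simps)
qed

lemma Re_theta_pos: "Re \<theta> > 0"
proof -
  have "0 < Re \<theta> * (2 * (\<beta> * q))" using Re_theta forms_pos(1) by simp
  moreover have "0 < 2 * (\<beta> * q)" using q_pos pos by simp
  ultimately show ?thesis by (rule zero_less_mult_pos2)
qed

section \<open>Estimates by extreme eigenvalues\<close>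

lemma kappa_bounds: "\<kappa>_min * p \<le> a" "a \<le> \<kappa>_max * p"
  by (intro lambda_min_le_qform qform_le_lambda_max spd blocks_symmetric)+

lemma kappa_max_pos: "\<kappa>_max > 0"
  using kappa_bounds(2) forms_pos by (metis order_less_le_trans zero_less_mult_pos2)

lemma tau_bounds:
  "\<tau>_min * q \<le> qform (B ** matrix_inv P ** transpose B) v"
  "qform (B ** matrix_inv P ** transpose B) v \<le> \<tau>_max * q"
  using lambda_min_le_qform[OF spd(3) transpose_gram[OF spd(2)]]
    qform_le_lambda_max[OF spd(3) transpose_gram[OF spd(2)]]
  by (simp_all add: matrix_mul_assoc)

lemma beta_bound: "qform (transpose C ** matrix_inv W ** C) v \<le> \<beta>_max * q"
  using qform_le_lambda_max[OF spd(3) transpose_gram[OF spd(4), of "transpose C"]]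
  by (simp add: matrix_mul_assoc)

lemma gram_nonneg: "spd S \<Longrightarrow> qform (M ** matrix_inv S ** transpose M) x \<ge> 0"
  by (simp add: cdot_gram qform_nonneg)

lemma tau_max_nonneg: "\<tau>_max \<ge> 0"
  using tau_bounds(2) gram_nonneg[OF spd(2), of B v] q_pos
  by (metis order_trans zero_le_mult_iff not_less)

lemma beta_max_nonneg: "\<beta>_max \<ge> 0"
  using beta_bound gram_nonneg[OF spd(4), of "transpose C" v] q_pos
  by (simp, metis order_trans zero_le_mult_iff not_less)

lemma z_bound: "(cmod z)\<^sup>2 \<le> \<tau>_max * q * p"
  using cauchy_schwarz_gram[OF spd(2), of v B u] tau_bounds(2) forms_pos
  by (meson less_imp_le mult_right_mono order_trans)

text \<open>Cauchy-Schwarz for \<open>w* C v\<close>, which \<open>wC\<close> evaluates as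
  \<open>\<theta> \<gamma> r\<close>, followed by cancelling one factor \<open>r\<close>. The case
  \<open>r = 0\<close> is therefore separate.\<close>

lemma w_bound: "(cmod \<theta>)\<^sup>2 * \<gamma>\<^sup>2 * r \<le> \<beta>_max * q"
proof (cases "r = 0")
  case True
  then show ?thesis using beta_max_nonneg q_pos by simp
next
  case False
  have "(cmod (cdot w (cmat C *v v)))\<^sup>2 = (cmod (cdot v (cmat (transpose C) *v w)))\<^sup>2"
    by (simp add: cdot_C del: transpose_matrix_vector)
  also have "\<dots> \<le> qform (transpose C ** matrix_inv W ** C) v * r"
    using cauchy_schwarz_gram[OF spd(4), of v "transpose C" w] by simp
  also have "\<dots> \<le> \<beta>_max * q * r"
    using beta_bound forms_pos by (intro mult_right_mono)
  finally have "((cmod \<theta>)\<^sup>2 * \<gamma>\<^sup>2 * r) * r \<le> (\<beta>_max * q) * r"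
    by (simp add: wC norm_mult power_mult_distrib power2_eq_square mult_ac)
  then show ?thesis using False forms_pos(4) by simp
qed

lemma Im_bound: "(Im \<theta>)\<^sup>2 \<le> 1 / (\<alpha> * \<beta>) * \<tau>_max + 1 / (\<beta> * \<gamma>) * \<beta>_max"
proof -
  have "Im z = Im \<theta> * (\<gamma> * r - \<beta> * q)"
    by (simp add: z_eq algebra_simps)
  also have "\<gamma> * r - \<beta> * q = - \<alpha> * p" using balance by simp
  finally have "(Im \<theta> * (\<alpha> * p))\<^sup>2 = (Im z)\<^sup>2" by (simp add: power2_eq_square)
  also have "\<dots> \<le> (cmod z)\<^sup>2" by (simp add: cmod_power2)
  also have "\<dots> \<le> \<tau>_max * q * p" by (rule z_bound)
  finally have "((Im \<theta>)\<^sup>2 * \<alpha>\<^sup>2 * p) * p \<le> (\<tau>_max * q) * p"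
    by (simp add: power_mult_distrib power2_eq_square mult_ac)
  \<comment> \<open>Facts \<open>1\<close> and \<open>2\<close> treat the two summands of
    \<open>\<beta> q = \<alpha> p + \<gamma> r\<close>, so that adding them leaves only multiples of
    \<open>q\<close>.\<close>
  then have 1: "(Im \<theta>)\<^sup>2 * \<alpha> * p \<le> \<tau>_max * q / \<alpha>"
    using forms_pos pos by (simp add: field_simps power2_eq_square)
  have "(Im \<theta>)\<^sup>2 * (\<gamma>\<^sup>2 * r) \<le> (cmod \<theta>)\<^sup>2 * (\<gamma>\<^sup>2 * r)"
    using forms_pos by (intro mult_right_mono) (simp_all add: cmod_power2)
  with w_bound have "(Im \<theta>)\<^sup>2 * (\<gamma>\<^sup>2 * r) \<le> \<beta>_max * q" by (simp add: mult_ac)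
  then have 2: "(Im \<theta>)\<^sup>2 * \<gamma> * r \<le> \<beta>_max * q / \<gamma>"
    using pos by (simp add: field_simps power2_eq_square)
  have "(Im \<theta>)\<^sup>2 * \<beta> * q = (Im \<theta>)\<^sup>2 * (\<alpha> * p + \<gamma> * r)"
    using balance by (simp add: mult.assoc)
  also have "\<dots> \<le> (\<tau>_max / \<alpha> + \<beta>_max / \<gamma>) * q"
    using 1 2 by (simp add: algebra_simps)
  finally have "(Im \<theta>)\<^sup>2 * \<beta> \<le> \<tau>_max / \<alpha> + \<beta>_max / \<gamma>"
    using q_pos by simp
  then have "(Im \<theta>)\<^sup>2 \<le> (\<tau>_max / \<alpha> + \<beta>_max / \<gamma>) / \<beta>"
    using pos by (simp add: pos_le_divide_eq)
  also have "\<dots> = 1 / (\<alpha> * \<beta>) * \<tau>_max + 1 / (\<beta> * \<gamma>) * \<beta>_max"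
    by (simp add: add_divide_distrib mult.commute)
  finally show ?thesis .
qed

text \<open>Since \<open>\<alpha> p \<le> \<beta> q\<close> by \<open>balance\<close>, replacing
  \<open>\<beta> q\<close> in \<open>Re_theta\<close> keeps the inequality and leaves only
  \<open>p\<close> to cancel.\<close>

lemma Re_upper: "Re \<theta> \<le> \<kappa>_max / (2 * \<alpha>)"
proof -
  have "2 * Re \<theta> * (\<alpha> * p) \<le> 2 * Re \<theta> * (\<beta> * q)"
    using Re_theta_pos pos forms_pos by (intro mult_left_mono) (simp_all add: balance)
  also have "\<dots> \<le> \<kappa>_max * p" using Re_theta kappa_bounds(2) by simp
  finally have "(2 * Re \<theta> * \<alpha>) * p \<le> \<kappa>_max * p" by (simp add: mult_ac)
  then show ?thesis using forms_pos(2) pos by (simp add: field_simps)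
qed

lemma q_upper:
  "\<tau>_min * (\<beta> * q) \<le> (\<beta> * \<kappa>_max\<^sup>2 + \<alpha> * \<tau>_max + (\<alpha>\<^sup>2 / \<gamma>) * \<beta>_max) * p"
proof -
  define g where "g = cmat (matrix_inv P ** transpose B) *v v"
  \<comment> \<open>The form with \<open>transpose A\<close> fits \<open>cdot_gram\<close>. By
    symmetry \<open>h\<close> is \<open>P^-1 A u\<close>, and the first row becomes
    \<open>g = \<theta> \<alpha> u - h\<close>.\<close>
  define h where "h = cmat (matrix_inv P ** transpose A) *v u"
  have "cmat P *v (g + h) = cmat (P ** matrix_inv P) *v (cmat (transpose B) *v v + cmat A *v u)"
    by (simp add: g_def h_def blocks_symmetric(1) matrix_vector_right_distrib cmat_mult
        matrix_vector_mul_assoc matrix_mul_assoc del: transpose_matrix_vector)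
  also have "\<dots> = cmat P *v ((\<theta> * of_real \<alpha>) *s u)"
    using eq1 by (simp add: matrix_inv_mult[OF spd_invertible[OF spd(2)]] add.commute
        vector_scalar_commute del: transpose_matrix_vector)
  finally have "cmat (matrix_inv P ** P) *v (g + h) = cmat (matrix_inv P ** P) *v ((\<theta> * of_real \<alpha>) *s u)"
    by (simp add: cmat_mult flip: matrix_vector_mul_assoc)
  then have gh: "g = (\<theta> * of_real \<alpha>) *s u - h"
    by (simp add: matrix_inv_mult[OF spd_invertible[OF spd(2)]] algebra_simps)
  have uh: "cdot h (cmat P *v u) = of_real a"
    using cdot_gram(2)[OF spd(2), of A u u] by (simp add: h_def cdot_qform blocks_symmetric)
  have hu: "cdot u (cmat P *v h) = of_real a"
    using uh cdot_transpose[of u P h] cdot_commute[of "cmat P *v u" h] blocks_symmetric(2)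
    by (simp del: transpose_matrix_vector)
  have "of_real (qform P g) = cdot g (cmat P *v g)"
    by (simp add: cdot_qform blocks_symmetric)
  also have "\<dots> = of_real ((cmod \<theta>)\<^sup>2 * \<alpha>\<^sup>2 * p - 2 * \<alpha> * Re \<theta> * a + qform P h)"
    unfolding gh
    by (simp add: matrix_vector_mult_diff_distrib vector_scalar_commute cdot_diff_right
        cdot_diff_left cdot_smult_left cdot_smult_right cdot_qform blocks_symmetric uh hu complex_eq_iff
        cmod_power2)
      (simp add: power2_eq_square algebra_simps)
  finally have "qform P g = (cmod \<theta>)\<^sup>2 * \<alpha>\<^sup>2 * p - 2 * \<alpha> * Re \<theta> * a + qform P h"
    unfolding of_real_eq_iff .
  also have "(cmod \<theta>)\<^sup>2 = (Re \<theta>)\<^sup>2 + (Im \<theta>)\<^sup>2" by (rule cmod_power2)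
  also have "((Re \<theta>)\<^sup>2 + (Im \<theta>)\<^sup>2) * \<alpha>\<^sup>2 * p = \<alpha> * Re \<theta> * (Re \<theta> * (\<alpha> * p)) + (Im \<theta>)\<^sup>2 * (\<alpha>\<^sup>2 * p)"
    by (simp add: power2_eq_square algebra_simps)
  \<comment> \<open>The contribution of \<open>(Re \<theta>)^2\<close> is absorbed by the negative
    cross term \<open>- 2 \<alpha> (Re \<theta>) a\<close>, so only \<open>(Im \<theta>)^2\<close>
    remains, which \<open>Im_bound\<close> controls.\<close>
  also have "\<alpha> * Re \<theta> * (Re \<theta> * (\<alpha> * p)) \<le> \<alpha> * Re \<theta> * (2 * a)"
  proof (intro mult_left_mono)
    have "Re \<theta> * (\<alpha> * p) \<le> Re \<theta> * (\<beta> * q)"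
      using Re_theta_pos pos forms_pos by (intro mult_left_mono) (simp_all add: balance)
    also have "\<dots> \<le> 2 * a" using Re_theta forms_pos(1) by linarith
    finally show "Re \<theta> * (\<alpha> * p) \<le> 2 * a" .
  qed (use Re_theta_pos pos in simp)
  also have "qform P h \<le> \<kappa>_max\<^sup>2 * p"
    using qform_gram_le[OF spd(2,1), of u] cdot_gram(1)[OF spd(2), of A u] by (simp add: h_def)
  finally have "qform P g \<le> (Im \<theta>)\<^sup>2 * (\<alpha>\<^sup>2 * p) + \<kappa>_max\<^sup>2 * p" by simp
  moreover have "\<tau>_min * q \<le> qform P g"
    using tau_bounds(1) cdot_gram(1)[OF spd(2), of B v] by (simp add: g_def)
  moreover have "(Im \<theta>)\<^sup>2 * (\<alpha>\<^sup>2 * p)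
      \<le> (1 / (\<alpha> * \<beta>) * \<tau>_max + 1 / (\<beta> * \<gamma>) * \<beta>_max) * (\<alpha>\<^sup>2 * p)"
    using Im_bound forms_pos(2) by (intro mult_right_mono) auto
  ultimately have "\<tau>_min * q \<le> (1 / (\<alpha> * \<beta>) * \<tau>_max + 1 / (\<beta> * \<gamma>) * \<beta>_max) * (\<alpha>\<^sup>2 * p) + \<kappa>_max\<^sup>2 * p"
    by linarith
  then have "\<beta> * (\<tau>_min * q)
      \<le> \<beta> * ((1 / (\<alpha> * \<beta>) * \<tau>_max + 1 / (\<beta> * \<gamma>) * \<beta>_max) * (\<alpha>\<^sup>2 * p) + \<kappa>_max\<^sup>2 * p)"
    using pos by (intro mult_left_mono) auto
  also have "\<dots> = (\<beta> * \<kappa>_max\<^sup>2 + \<alpha> * \<tau>_max + (\<alpha>\<^sup>2 / \<gamma>) * \<beta>_max) * p"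
    using pos by (simp add: field_simps power2_eq_square)
  finally show ?thesis by (simp add: mult_ac)
qed

text \<open>By \<open>Re_theta\<close> the real part is \<open>a / (2 \<beta> q)\<close>. Here
  \<open>a \<ge> \<kappa>_min p\<close>, and \<open>q_upper\<close> compares \<open>q\<close> with
  \<open>p\<close>.\<close>

lemma Re_lower:
  "\<kappa>_min * \<tau>_min / (2 * (\<beta> * \<kappa>_max\<^sup>2 + \<alpha> * \<tau>_max + (\<alpha>\<^sup>2 / \<gamma>) * \<beta>_max)) \<le> Re \<theta>"
proof -
  define D where "D = \<beta> * \<kappa>_max\<^sup>2 + \<alpha> * \<tau>_max + (\<alpha>\<^sup>2 / \<gamma>) * \<beta>_max"
  have D: "D > 0"
    unfolding D_def using pos kappa_max_pos tau_max_nonneg beta_max_nonneg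
    by (intro add_pos_nonneg) auto
  have k: "\<kappa>_min > 0" by (rule lambda_min_pos[OF spd(2,1)])
  have "(\<kappa>_min * \<tau>_min) * (\<beta> * q) \<le> \<kappa>_min * (D * p)"
    using q_upper k by (simp add: D_def mult.assoc)
  also have "\<dots> \<le> D * a"
    using kappa_bounds(1) D by (simp add: mult.left_commute)
  also have "\<dots> = (2 * D * Re \<theta>) * (\<beta> * q)"
    using Re_theta by simp
  finally have "\<kappa>_min * \<tau>_min \<le> 2 * D * Re \<theta>"
    using q_pos pos by (simp add: mult_le_cancel_right)
  then have "\<kappa>_min * \<tau>_min / (2 * D) \<le> Re \<theta>"
    using D by (simp add: pos_divide_le_eq mult_ac)
  then show ?thesis by (simp only: D_def)
qed

text \<open>With \<open>r = 0\<close> the balance reads \<open>\<beta> q = \<alpha> p\<close>, so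
  \<open>Re_theta\<close> involves only \<open>a / p\<close>. Also
  \<open>z = - \<theta> \<beta> q\<close>, and \<open>z_bound\<close> then limits
  \<open>\<theta>\<close> itself.\<close>

lemma Cv_zero_bounds:
  assumes "cmat C *v v = 0"
  shows "\<kappa>_min / (2 * \<alpha>) \<le> Re \<theta>" and "(cmod \<theta>)\<^sup>2 \<le> \<tau>_max / (\<alpha> * \<beta>)"
proof -
  have r: "r = 0" using w_zero[OF assms] .
  then have bal: "\<beta> * q = \<alpha> * p" using balance by simp
  then have "a = (2 * Re \<theta> * \<alpha>) * p" using Re_theta by simp
  then have "\<kappa>_min * p \<le> (2 * Re \<theta> * \<alpha>) * p" using kappa_bounds(1) by simp
  then show "\<kappa>_min / (2 * \<alpha>) \<le> Re \<theta>"
    using forms_pos(2) pos by (simp add: field_simps)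
  have "(cmod z)\<^sup>2 = (cmod \<theta>)\<^sup>2 * (\<beta> * q)\<^sup>2"
    using r by (simp add: z_eq norm_mult power_mult_distrib)
  also have "(\<beta> * q)\<^sup>2 = (\<alpha> * \<beta>) * (q * p)"
    using bal by (simp add: power2_eq_square)
  finally have "((cmod \<theta>)\<^sup>2 * (\<alpha> * \<beta>)) * (q * p) \<le> \<tau>_max * (q * p)"
    using z_bound by (simp add: mult.assoc)
  then have "(cmod \<theta>)\<^sup>2 * (\<alpha> * \<beta>) \<le> \<tau>_max"
    using q_pos forms_pos(2) by (simp add: mult_le_cancel_right zero_less_mult_iff)
  then show "(cmod \<theta>)\<^sup>2 \<le> \<tau>_max / (\<alpha> * \<beta>)"
    using pos by (simp add: field_simps)
qed

end

section \<open>Return from the shifted eigenvalue to \<open>lam\<close>\<close>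

lemma cmod_shift_inverse_bounds:
  assumes k: "0 \<le> k" "k \<le> Re \<theta>" and R: "(cmod \<theta>)\<^sup>2 \<le> R"
  shows "2 * k / (1 + k) \<le> cmod (2 * \<theta> / (1 + \<theta>))"
    and "cmod (2 * \<theta> / (1 + \<theta>)) \<le> sqrt (4 * R / (1 + 2 * k + R))"
proof -
  define s where "s = cmod \<theta>"
  have "k \<le> s" unfolding s_def using k complex_Re_le_cmod order_trans by blast
  have sq: "(cmod (1 + \<theta>))\<^sup>2 = 1 + 2 * Re \<theta> + s\<^sup>2"
    unfolding s_def cmod_power2 by (simp add: power2_eq_square algebra_simps)
  have "1 + \<theta> \<noteq> 0" using k by (auto simp: complex_eq_iff)
  \<comment> \<open>The map \<open>t / (1 + t)\<close> is increasing for \<open>t \<ge> 0\<close>;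
    the triangle inequality then replaces \<open>1 + s\<close> by
    \<open>cmod (1 + \<theta>)\<close>.\<close>
  have "2 * k / (1 + k) \<le> 2 * s / (1 + s)"
    using k \<open>k \<le> s\<close> by (simp add: divide_simps) (simp add: algebra_simps)
  also have "\<dots> \<le> 2 * s / cmod (1 + \<theta>)"
    using \<open>1 + \<theta> \<noteq> 0\<close> norm_triangle_ineq[of 1 \<theta>]
    by (intro divide_left_mono) (simp_all add: s_def add_pos_nonneg)
  finally show "2 * k / (1 + k) \<le> cmod (2 * \<theta> / (1 + \<theta>))"
    by (simp add: s_def norm_divide norm_mult)
  have "0 \<le> R" using R zero_le_power2 order_trans by blast
  have "(cmod (2 * \<theta> / (1 + \<theta>)))\<^sup>2 = 4 * s\<^sup>2 / (1 + 2 * Re \<theta> + s\<^sup>2)"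
    unfolding sq[symmetric] unfolding s_def
    by (simp add: norm_divide norm_mult power_divide power_mult_distrib)
  also have "\<dots> \<le> 4 * s\<^sup>2 / (1 + 2 * k + s\<^sup>2)"
    using k by (intro divide_left_mono) (simp_all add: add_pos_nonneg)
  \<comment> \<open>Monotonicity of \<open>t / (1 + 2 k + t)\<close> in \<open>t = s^2\<close>,
    checked by cross-multiplication.\<close>
  also have "\<dots> \<le> 4 * R / (1 + 2 * k + R)"
  proof -
    have "s\<^sup>2 * (1 + 2 * k) \<le> R * (1 + 2 * k)"
      using R k by (intro mult_right_mono) (simp_all add: s_def)
    moreover have "0 < 1 + 2 * k + s\<^sup>2" "0 < 1 + 2 * k + R"
      using k \<open>0 \<le> R\<close> by (simp_all add: add_pos_nonneg)
    ultimately show ?thesis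
      by (simp add: pos_divide_le_eq pos_le_divide_eq) (simp add: algebra_simps)
  qed
  finally show "cmod (2 * \<theta> / (1 + \<theta>)) \<le> sqrt (4 * R / (1 + 2 * k + R))"
    by (rule real_le_rsqrt)
qed

theorem corollary4p4:
  fixes A P :: "real^'n^'n"
    and B :: "real^'n^'m"
    and C :: "real^'m^'p"
    and Q :: "real^'m^'m"
    and W :: "real^'p^'p"
    and \<alpha> \<beta> \<gamma> :: real
    and lam :: complex
    and u :: "complex^'n" and v :: "complex^'m" and w :: "complex^'p"
  defines "\<kappa>_min \<equiv> lambda_min (matrix_inv P ** A)"
    and "\<kappa>_max \<equiv> lambda_max (matrix_inv P ** A)"
    and "\<tau>_max \<equiv> lambda_max (matrix_inv Q ** B ** matrix_inv P ** transpose B)"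
    and "\<tau>_min \<equiv> lambda_min (matrix_inv Q ** B ** matrix_inv P ** transpose B)"
    and "\<beta>_max \<equiv> lambda_max (matrix_inv Q ** transpose C ** matrix_inv W ** C)"
  assumes "spd A"
    and "rank B = CARD('m)" and "rank C = CARD('p)"
    and "spd P" and "spd Q" and "spd W"
    and "\<alpha> > 0" and "\<beta> > 0" and "\<gamma> > 0"
    and "eigenvector (cmat (matrix_inv (P_EGSS \<alpha> \<beta> \<gamma> P Q W A B C) ** saddle_mat A B C))
           (block_vec3 u v w) lam"
    and "Im lam \<noteq> 0"
  shows "(cmat C *v v = 0 \<longrightarrow>
            2 * \<kappa>_min / (2 * \<alpha> + \<kappa>_min) \<le> cmod lam \<and>
            cmod lam \<le> sqrt (4 * \<tau>_max / (\<alpha> * \<beta> + \<beta> * \<kappa>_min + \<tau>_max))) \<and>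
         (cmat C *v v \<noteq> 0 \<longrightarrow>
            \<kappa>_min * \<tau>_min / (2 * (\<beta> * \<kappa>_max\<^sup>2 + \<alpha> * \<tau>_max + (\<alpha>\<^sup>2 / \<gamma>) * \<beta>_max))
              \<le> Re (lam / (2 - lam)) \<and>
            Re (lam / (2 - lam)) \<le> \<kappa>_max / (2 * \<alpha>) \<and>
            \<bar>Im (lam / (2 - lam))\<bar>
              \<le> sqrt (1 / (\<alpha> * \<beta>) * \<tau>_max + 1 / (\<beta> * \<gamma>) * \<beta>_max))"
proof -
  note pos = \<open>\<alpha> > 0\<close> \<open>\<beta> > 0\<close> \<open>\<gamma> > 0\<close>
  define \<theta> where "\<theta> = lam / (2 - lam)"
  have "lam \<noteq> 2" using \<open>Im lam \<noteq> 0\<close> by auto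
  then have "1 + \<theta> = 2 / (2 - lam)" by (simp add: \<theta>_def field_simps)
  then have lam: "lam = 2 * \<theta> / (1 + \<theta>)"
    using \<open>lam \<noteq> 2\<close> by (simp add: \<theta>_def)
  have "Im \<theta> \<noteq> 0"
  proof
    assume "Im \<theta> = 0"
    then have "\<theta> = of_real (Re \<theta>)" by (simp add: complex_eq_iff)
    then have "lam = of_real (2 * Re \<theta> / (1 + Re \<theta>))" by (subst lam) simp
    then show False using \<open>Im lam \<noteq> 0\<close> by (metis Im_complex_of_real)
  qed
  note shift = EGSS_eigenvector_shift[OF invertible_P_EGSS
      [OF \<open>spd A\<close> \<open>spd P\<close> \<open>spd Q\<close> \<open>spd W\<close> pos] assms(15) \<open>lam \<noteq> 2\<close>, folded \<theta>_def]
  have "block_vec3 u v w \<noteq> 0" using assms(15) by (simp add: eigenvector_def)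
  then have "u \<noteq> 0 \<or> v \<noteq> 0 \<or> w \<noteq> 0" using block_vec3_zero by metis
  then interpret EGSS_eigenpair A P B C Q W \<alpha> \<beta> \<gamma> \<theta> u v w
    using assms shift \<open>Im \<theta> \<noteq> 0\<close> by unfold_locales (simp_all del: transpose_matrix_vector)
  have k: "\<kappa>_min > 0" unfolding \<kappa>_min_def by (rule lambda_min_pos[OF \<open>spd P\<close> \<open>spd A\<close>])
  show ?thesis
  proof (intro conjI impI)
    assume "cmat C *v v = 0"
    \<comment> \<open>Instantiates \<open>k = \<kappa>_min / (2 \<alpha>)\<close> and
      \<open>R = \<tau>_max / (\<alpha> \<beta>)\<close>. Clearing the inner denominators,
      \<open>2 \<alpha>\<close> below and \<open>\<alpha> \<beta>\<close> above, gives the stated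
      bounds.\<close>
    note bounds = cmod_shift_inverse_bounds[OF _ Cv_zero_bounds[OF this], folded lam]
    have "2 * \<kappa>_min / (2 * \<alpha> + \<kappa>_min) = 2 * (\<kappa>_min / (2 * \<alpha>)) / (1 + \<kappa>_min / (2 * \<alpha>))"
      using k pos by (simp add: field_simps add_pos_pos)
    then show "2 * \<kappa>_min / (2 * \<alpha> + \<kappa>_min) \<le> cmod lam"
      using bounds(1) k pos by (simp add: \<kappa>_min_def)
    have "4 * (\<tau>_max / (\<alpha> * \<beta>)) / (1 + 2 * (\<kappa>_min / (2 * \<alpha>)) + \<tau>_max / (\<alpha> * \<beta>))
        = 4 * \<tau>_max / (\<alpha> * \<beta>) / ((\<alpha> * \<beta> + \<beta> * \<kappa>_min + \<tau>_max) / (\<alpha> * \<beta>))"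
      using pos by (simp add: add_divide_distrib)
    also have "\<dots> = 4 * \<tau>_max / (\<alpha> * \<beta> + \<beta> * \<kappa>_min + \<tau>_max)"
      using pos by simp
    finally have eq: "4 * (\<tau>_max / (\<alpha> * \<beta>)) / (1 + 2 * (\<kappa>_min / (2 * \<alpha>)) + \<tau>_max / (\<alpha> * \<beta>))
        = 4 * \<tau>_max / (\<alpha> * \<beta> + \<beta> * \<kappa>_min + \<tau>_max)" .
    have "0 \<le> \<kappa>_min / (2 * \<alpha>)" using k pos by simp
    then show "cmod lam \<le> sqrt (4 * \<tau>_max / (\<alpha> * \<beta> + \<beta> * \<kappa>_min + \<tau>_max))"
      using bounds(2) unfolding \<kappa>_min_def[symmetric] \<tau>_max_def[symmetric] eq by blast
  next
    show "\<kappa>_min * \<tau>_min / (2 * (\<beta> * \<kappa>_max\<^sup>2 + \<alpha> * \<tau>_max + (\<alpha>\<^sup>2 / \<gamma>) * \<beta>_max))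
        \<le> Re (lam / (2 - lam))"
      using Re_lower by (simp add: \<kappa>_min_def \<kappa>_max_def \<tau>_min_def \<tau>_max_def \<beta>_max_def \<theta>_def)
    show "Re (lam / (2 - lam)) \<le> \<kappa>_max / (2 * \<alpha>)"
      using Re_upper by (simp add: \<kappa>_max_def \<theta>_def)
    show "\<bar>Im (lam / (2 - lam))\<bar> \<le> sqrt (1 / (\<alpha> * \<beta>) * \<tau>_max + 1 / (\<beta> * \<gamma>) * \<beta>_max)"
      using real_sqrt_le_mono[OF Im_bound] by (simp add: \<tau>_max_def \<beta>_max_def \<theta>_def)
  qed
qed

end
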